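(* Let $p\in[1,\infty)$ and let $\Omega\subset\mathbb{R}^N$, $N\ge2$, be a bounded domain with boundary $\Gamma$ of class $C^2$. Set $h=q-u$, where $u$ is the solution of $\Delta u=N$ in $\Omega$, $u=0$ on $\Gamma$, and $q(x)=\frac12(|x-z|^2-a)$ with any $z\in\Omega$ and $a\in\mathbb{R}$. Let $\rho_i=\min_{x\in\Gamma}|x-z|$, $\rho_e=\max_{x\in\Gamma}|x-z|$, and let $h_\Omega$ be the mean value of $h$ in $\Omega$. Then there exists a positive constant $C$ such that $$\rho_e-\rho_i\le C\,\|h-h_\Omega\|_{L^p(\Omega)}^{p/(N+p)}.$$ The constant $C$ depends only on $N$, $p$, $d_\Omega$, $r_i$, $r_e$. If $\Omega$ is convex, the dependence on $r_e$ can be removed.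
   Context: A domain is a connected open set. $h_\Omega=\frac1{|\Omega|}\int_\Omega h\,dx$. $d_\Omega$ is the diameter of $\Omega$. Since $\Gamma$ is of class $C^2$, $\Omega$ satisfies uniform interior and exterior sphere conditions, whose radii are $r_i$ and $r_e$: for each $y\in\Gamma$ there is a ball of radius $r_i$ contained in $\Omega$ (respectively, a ball of radius $r_e$ contained in $\mathbb{R}^N\setminus\overline\Omega$) whose closure intersects $\Gamma$ only at $y$. *)

theory Defs
  imports "HOL-Analysis.Analysis"
begin

definition partial_deriv :: "'n::finite \<Rightarrow> (real^'n \<Rightarrow> real) \<Rightarrow> real^'n \<Rightarrow> real" where
  "partial_deriv i f x = frechet_derivative f (at x) (axis i 1)"

definition laplacian :: "(real^'n::finite \<Rightarrow> real) \<Rightarrow> real^'n \<Rightarrow> real" where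
  "laplacian f x = (\<Sum>i\<in>UNIV. partial_deriv i (partial_deriv i f) x)"

text \<open>Meant for open \<open>S\<close>: the derivatives are unrestricted, at the points of \<open>S\<close>.\<close>

definition C2_on :: "(real^'n::finite) set \<Rightarrow> (real^'n \<Rightarrow> real) \<Rightarrow> bool" where
  "C2_on S f \<longleftrightarrow>
     (\<forall>x\<in>S. f differentiable (at x)) \<and>
     (\<forall>i. \<forall>x\<in>S. partial_deriv i f differentiable (at x)) \<and>
     (\<forall>i j. continuous_on S (partial_deriv j (partial_deriv i f)))"

definition domain :: "(real^'n::finite) set \<Rightarrow> bool" where
  "domain \<Omega> \<longleftrightarrow> open \<Omega> \<and> connected \<Omega> \<and> \<Omega> \<noteq> {}"

text \<open>
  Near each boundary point, \<open>\<Omega>\<close> is the region above the graph of a \<open>C\<^sup>2\<close> function in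
  some direction \<open>e\<close>. The function is one of \<open>N - 1\<close> variables: only its values on the
  hyperplane orthogonal to \<open>e\<close>, on which \<open>x - (x \<bullet> e) *\<^sub>R e\<close> is the projection of \<open>x\<close>, are used.
\<close>

definition C2_boundary :: "(real^'n::finite) set \<Rightarrow> bool" where
  "C2_boundary \<Omega> \<longleftrightarrow>
     (\<forall>y\<in>frontier \<Omega>. \<exists>r>0. \<exists>e \<gamma>. norm e = 1 \<and> C2_on UNIV \<gamma> \<and>
        \<Omega> \<inter> ball y r = {x \<in> ball y r. x \<bullet> e > \<gamma> (x - (x \<bullet> e) *\<^sub>R e)})"

definition interior_sphere :: "(real^'n::finite) set \<Rightarrow> real \<Rightarrow> bool" where
  "interior_sphere \<Omega> r \<longleftrightarrow> r > 0 \<and>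
     (\<forall>y\<in>frontier \<Omega>. \<exists>c. ball c r \<subseteq> \<Omega> \<and> closure (ball c r) \<inter> frontier \<Omega> = {y})"

definition exterior_sphere :: "(real^'n::finite) set \<Rightarrow> real \<Rightarrow> bool" where
  "exterior_sphere \<Omega> r \<longleftrightarrow> r > 0 \<and>
     (\<forall>y\<in>frontier \<Omega>. \<exists>c. ball c r \<subseteq> - closure \<Omega> \<and> closure (ball c r) \<inter> frontier \<Omega> = {y})"

text \<open>
  Classical solutions of \<open>\<Delta>u = N\<close> in \<open>\<Omega>\<close>, \<open>u = 0\<close> on the boundary. The values of \<open>u\<close>
  outside the closure of \<open>\<Omega>\<close> are irrelevant.
\<close>

definition torsion_solution :: "(real^'n::finite) set \<Rightarrow> (real^'n \<Rightarrow> real) \<Rightarrow> bool" where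
  "torsion_solution \<Omega> u \<longleftrightarrow>
     C2_on \<Omega> u \<and> continuous_on (closure \<Omega>) u \<and>
     (\<forall>x\<in>\<Omega>. laplacian u x = real CARD('n)) \<and>
     (\<forall>x\<in>frontier \<Omega>. u x = 0)"

definition mean_value :: "(real^'n::finite) set \<Rightarrow> (real^'n \<Rightarrow> real) \<Rightarrow> real" where
  "mean_value \<Omega> f = (LINT x:\<Omega>|lborel. f x) / measure lborel \<Omega>"

definition Lp_norm :: "real \<Rightarrow> (real^'n::finite) set \<Rightarrow> (real^'n \<Rightarrow> real) \<Rightarrow> real" where
  "Lp_norm p \<Omega> f = (LINT x:\<Omega>|lborel. \<bar>f x\<bar> powr p) powr (1 / p)"

text \<open>
  For a nonempty bounded open \<open>\<Omega>\<close> the boundary is compact and nonempty, so the infimum and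
  the supremum below are attained.
\<close>

definition rho_i :: "(real^'n::finite) set \<Rightarrow> real^'n \<Rightarrow> real" where
  "rho_i \<Omega> z = (INF x\<in>frontier \<Omega>. norm (x - z))"

definition rho_e :: "(real^'n::finite) set \<Rightarrow> real^'n \<Rightarrow> real" where
  "rho_e \<Omega> z = (SUP x\<in>frontier \<Omega>. norm (x - z))"

end

theory Submission
  imports Defs
begin

text \<open>
  On the boundary \<open>h = q\<close>, so \<open>\<rho>\<^sub>e\<^sup>2 - \<rho>\<^sub>i\<^sup>2\<close> is twice a difference of boundary values of \<open>h\<close>, while
  \<open>\<rho>\<^sub>e \<ge> r\<^sub>i\<close>. At depth \<open>s < r\<^sub>i\<close> inside the touching interior ball, \<open>h\<close> differs from its boundary
  value by \<open>O(s)\<close>: no gradient bound is needed, since a barrier built on the exterior ball gives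
  \<open>0 \<le> -u \<le> M s\<close> there. As \<open>h\<close> is harmonic, it is its own mean against a bump of
  radius \<open>s/2\<close>; with \<open>t \<le> s + s\<^bsup>1-p\<^esup> t\<^bsup>p\<^esup>\<close> in place of Hoelder's inequality this bounds the deviation from
  any constant by \<open>s + C s\<^bsup>1-p-N\<^esup> I\<close>, where \<open>I\<close> is the integral of the \<open>p\<close>-th power of the deviation.
  The choice \<open>s = I\<^bsup>1/(N+p)\<^esup>\<close> balances the two terms. A convex domain has exterior
  spheres of every radius.
\<close>

section \<open>A weighted mean value property\<close>

text \<open>By translation invariance the integral of \<open>F (x + t *\<^sub>R e)\<close> does not
  depend on \<open>t\<close>; differentiating under the integral at \<open>t = 0\<close> gives the
  claim. The parameter runs over [0,1], so that derivative is one-sided.\<close>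

lemma integral_derivative_eq_0:
  fixes F :: "'a::euclidean_space \<Rightarrow> real" and L :: "'a \<Rightarrow> 'a \<Rightarrow> real"
  assumes der: "\<And>x. (F has_derivative L x) (at x)"
    and cont: "continuous_on UNIV (\<lambda>x. L x e)"
    and supp: "\<And>x. x \<notin> cball 0 1 \<Longrightarrow> F x = 0" "\<And>x. x \<notin> cball 0 1 \<Longrightarrow> L x e = 0"
  shows "(LINT x|lborel. L x e) = 0"
proof -
  \<comment> \<open>The radius \<open>1 + norm e\<close> leaves room for every shift of the unit
    ball by at most \<open>norm e\<close>, so one compact box serves the Leibniz rule for all
    \<open>t\<close>.\<close>
  obtain b :: 'a where sub: "cball 0 (1 + norm e) \<subseteq> cbox (-b) b"
    using bounded_subset_cbox_symmetric[OF bounded_cball] by metis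
  have contF: "continuous_on UNIV F"
    using der has_derivative_continuous_on[of UNIV F L] by simp
  \<comment> \<open>The shifted function vanishes off the box, so the box integral is the full one,
    where the shift can be undone.\<close>
  have eq: "integral (cbox (-b) b) (\<lambda>x. f (x + t *\<^sub>R e)) = (LINT x|lborel. f x)"
    if f: "continuous_on UNIV f" "\<And>x. x \<notin> cball 0 1 \<Longrightarrow> f x = 0" and t: "t \<in> {0..1}"
    for f :: "'a \<Rightarrow> real" and t
  proof -
    have out: "f (x + t *\<^sub>R e) = 0" if "x \<notin> cbox (-b) b" for x
    proof -
      have "norm x > 1 + norm e"
      proof (rule ccontr)
        assume "\<not> norm x > 1 + norm e"
        then have "x \<in> cball 0 (1 + norm e)" by simp
        with that sub show False by blast
      qed
      moreover have "norm (t *\<^sub>R e) \<le> norm e" using t by (simp add: mult_left_le_one_le)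
      moreover have "norm x \<le> norm (x + t *\<^sub>R e) + norm (t *\<^sub>R e)"
        by (metis add_diff_cancel norm_triangle_ineq4)
      ultimately show ?thesis by (intro f) auto
    qed
    have "continuous_on (cbox (-b) b) (\<lambda>x. f (x + t *\<^sub>R e))"
      by (intro continuous_on_compose2[OF f(1)] continuous_intros) auto
    from borel_integrable_compact[OF compact_cbox this]
    have int: "set_integrable lborel (cbox (-b) b) (\<lambda>x. f (x + t *\<^sub>R e))"
      by (simp add: set_integrable_def)
    have "integral (cbox (-b) b) (\<lambda>x. f (x + t *\<^sub>R e)) = (LINT x:cbox (-b) b|lborel. f (x + t *\<^sub>R e))"
      using set_borel_integral_eq_integral(2)[OF int] by simp
    also have "\<dots> = (LINT x|lborel. f (t *\<^sub>R e + x))"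
      unfolding set_lebesgue_integral_def
      by (intro Bochner_Integration.integral_cong) (auto simp: out indicator_def add.commute)
    also have "\<dots> = (LINT x|distr lborel borel ((+) (t *\<^sub>R e)). f x)"
      using f(1) by (subst integral_distr) (auto intro: borel_measurable_continuous_onI)
    finally show ?thesis by (simp add: lborel_distr_plus)
  qed
  have "((\<lambda>t. integral (cbox (-b) b) (\<lambda>x. F (x + t *\<^sub>R e))) has_real_derivative
      integral (cbox (-b) b) (\<lambda>x. L (x + 0 *\<^sub>R e) e)) (at 0 within {0..1})"
  proof (rule leibniz_rule_field_derivative[where fx = "\<lambda>t x. L (x + t *\<^sub>R e) e"])
    fix t x
    have "((\<lambda>t. F (x + t *\<^sub>R e)) has_derivative (\<lambda>s. L (x + t *\<^sub>R e) (s *\<^sub>R e))) (at t within {0..1})"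
      by (rule has_derivative_compose[OF _ der, where f = "\<lambda>t. x + t *\<^sub>R e"])
         (auto intro!: derivative_eq_intros)
    moreover have "linear (L (x + t *\<^sub>R e))" using der has_derivative_linear by blast
    ultimately show "((\<lambda>t. F (x + t *\<^sub>R e)) has_real_derivative L (x + t *\<^sub>R e) e) (at t within {0..1})"
      by (simp add: has_field_derivative_def linear_cmul mult_commute_abs)
  next
    show "(\<lambda>x. F (x + t *\<^sub>R e)) integrable_on cbox (-b) b" for t
      by (intro integrable_continuous continuous_on_compose2[OF contF] continuous_intros) auto
    show "continuous_on ({0..1} \<times> cbox (-b) b) (\<lambda>(t, x). L (x + t *\<^sub>R e) e)"
      unfolding case_prod_unfold
      by (intro continuous_on_compose2[OF cont] continuous_intros) auto
  qed auto
  then have D: "((\<lambda>t. integral (cbox (-b) b) (\<lambda>x. F (x + t *\<^sub>R e))) has_real_derivative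
      (LINT x|lborel. L x e)) (at 0 within {0..1})"
    using eq[OF cont supp(2), of 0] by simp
  have "((\<lambda>t. LINT x|lborel. F x) has_real_derivative (LINT x|lborel. L x e)) (at 0 within {0..1})"
    by (rule has_field_derivative_transform_within[OF D zero_less_one]) (use eq[OF contF supp(1)] in auto)
  moreover have "((\<lambda>t. LINT x|lborel. F x) has_real_derivative 0) (at 0 within {0..1})"
    by simp
  ultimately show ?thesis
    by (intro has_field_derivative_unique) (auto simp: at_within_Icc_at_right)
qed

section \<open>The truncated paraboloid as a weight\<close>

lemma has_real_derivative_pos_part_power2:
  "((\<lambda>s::real. (max 0 s)\<^sup>2) has_real_derivative 2 * max 0 s) (at s)"
proof -
  consider "s > 0" | "s < 0" | "s = 0" by linarith
  then show ?thesis
  proof cases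
    case 1
    have "((\<lambda>s::real. s\<^sup>2) has_real_derivative 2 * max 0 s) (at s)"
      using 1 by (auto intro!: derivative_eq_intros)
    then show ?thesis
      by (rule has_field_derivative_transform_within_open[of _ _ _ "{0<..}"]) (use 1 in auto)
  next
    case 2
    have "((\<lambda>s::real. 0) has_real_derivative 2 * max 0 s) (at s)"
      using 2 by auto
    then show ?thesis
      by (rule has_field_derivative_transform_within_open[of _ _ _ "{..<0}"]) (use 2 in auto)
  next
    case 3
    \<comment> \<open>At the kink the difference quotient is at most |h|: squaring removes the
      corner of the positive part.\<close>
    have "((\<lambda>h::real. (max 0 h)\<^sup>2 / h) \<longlongrightarrow> 0) (at 0)"
    proof (rule Lim_null_comparison)
      show "\<forall>\<^sub>F h::real in at 0. norm ((max 0 h)\<^sup>2 / h) \<le> \<bar>h\<bar>"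
        by (intro always_eventually) (auto simp: max_def power2_eq_square)
      show "((\<lambda>h::real. \<bar>h\<bar>) \<longlongrightarrow> 0) (at 0)" by (auto intro!: tendsto_eq_intros)
    qed
    then show ?thesis using 3 by (simp add: has_field_derivative_iff)
  qed
qed

text \<open>The weight has a corner on the unit sphere. That is harmless: only its square gets
  differentiated, and the gradient of the square is again the weight times
  \<open>- 4 * x\<close>.\<close>

definition bump :: "'a::euclidean_space \<Rightarrow> real" where
  "bump x = max 0 (1 - x \<bullet> x)"

lemma bump_nonneg: "0 \<le> bump x" and bump_le_1: "bump x \<le> 1"
  by (auto simp: bump_def)

lemma bump_eq_0_iff: "bump x = 0 \<longleftrightarrow> norm x \<ge> 1"
  using abs_square_less_1[of "norm x"] by (auto simp: bump_def dot_square_norm max_def)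

lemma bump_eq_0: "norm x \<ge> 1 \<Longrightarrow> bump x = 0"
  by (simp add: bump_eq_0_iff)

lemma continuous_on_bump [continuous_intros]:
  "continuous_on A f \<Longrightarrow> continuous_on A (\<lambda>x. bump (f x))"
  unfolding bump_def by (intro continuous_intros)

lemma has_derivative_bump_power2:
  "((\<lambda>x. (bump x)\<^sup>2) has_derivative (\<lambda>v. - 4 * bump x * (x \<bullet> v))) (at x)"
proof -
  have "((\<lambda>x. 1 - x \<bullet> x) has_derivative (\<lambda>v. - (2 * (x \<bullet> v)))) (at x)"
    by (auto intro!: derivative_eq_intros simp: inner_commute)
  from has_derivative_compose[OF this has_field_derivative_imp_has_derivative[OF has_real_derivative_pos_part_power2]]
  show ?thesis by (simp add: bump_def algebra_simps)
qed

lemma integrable_bump_mult: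
  fixes g :: "'a::euclidean_space \<Rightarrow> real"
  assumes "continuous_on (cball 0 1) g"
  shows "integrable lborel (\<lambda>x. bump x * g x)"
proof -
  have "integrable lborel (\<lambda>x. indicator (cball 0 1) x *\<^sub>R (bump x * g x))"
    by (intro borel_integrable_compact continuous_intros assms) auto
  moreover have "(\<lambda>x. indicator (cball 0 1) x *\<^sub>R (bump x * g x)) = (\<lambda>x. bump x * g x)"
  proof
    show "indicator (cball 0 1) x *\<^sub>R (bump x * g x) = bump x * g x" for x
      by (cases "norm x \<le> 1") (auto simp: bump_eq_0)
  qed
  ultimately show ?thesis by simp
qed

lemma integral_bump_pos: "0 < (LINT x|lborel. bump (x::'a::euclidean_space))"
proof -
  have int: "integrable lborel (bump :: 'a \<Rightarrow> real)"
    using integrable_bump_mult[of "\<lambda>_. 1"] by simp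
  have "(LINT x|lborel. bump (x::'a)) \<noteq> 0"
  proof
    assume "(LINT x|lborel. bump (x::'a)) = 0"
    then have "AE x in lborel. bump (x::'a) = 0"
      using integral_nonneg_eq_0_iff_AE[OF int] bump_nonneg by auto
    then have "AE x in lborel. (x::'a) \<notin> ball 0 1"
      by eventually_elim (simp add: bump_eq_0_iff)
    then have "ball (0::'a) 1 \<in> null_sets lborel"
      by (subst AE_iff_null_sets) auto
    then have "measure lborel (ball (0::'a) 1) = 0" by (simp add: measure_def null_setsD1)
    then show False using content_ball_pos[of 1 "0::'a"] by simp
  qed
  moreover have "(LINT x|lborel. bump (x::'a)) \<ge> 0"
    by (intro integral_nonneg_AE) (auto simp: bump_nonneg)
  ultimately show ?thesis by linarith
qed

text \<open>On \<open>C\<close> the product is zero whatever \<open>g\<close> is, and the closed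
  pieces \<open>A \<inter> B\<close> and \<open>A \<inter> C\<close> glue. This handles weighted
  integrands such as \<open>bump x * f (y + t *\<^sub>R x)\<close> where the argument of
  \<open>f\<close> leaves \<open>S\<close>.\<close>

lemma continuous_on_mult_supported:
  fixes k g :: "'a::topological_space \<Rightarrow> real"
  assumes "closed A" "closed B" "closed C" "A \<subseteq> B \<union> C"
    and k: "continuous_on A k" "\<And>x. x \<in> C \<Longrightarrow> k x = 0"
    and g: "continuous_on (A \<inter> B) g"
  shows "continuous_on A (\<lambda>x. k x * g x)"
proof -
  have "continuous_on (A \<inter> B) (\<lambda>x. k x * g x)"
    by (intro continuous_intros g continuous_on_subset[OF k(1)]) auto
  moreover have "continuous_on (A \<inter> C) (\<lambda>x. k x * g x)"
    by (rule continuous_on_eq[of _ "\<lambda>_. 0"]) (auto simp: k)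
  ultimately have "continuous_on (A \<inter> B \<union> A \<inter> C) (\<lambda>x. k x * g x)"
    using assms by (intro continuous_on_closed_Un) auto
  moreover have "A \<inter> B \<union> A \<inter> C = A" using assms by auto
  ultimately show ?thesis by simp
qed

text \<open>
  The derivative in \<open>t\<close> of \<open>\<integral> bump(x) f(y + t x) dx\<close> vanishes: the field \<open>bump(x) x\<close> is
  \<open>- \<nabla>(bump\<^sup>2) / 4\<close>, so integrating by parts moves the derivative to \<open>\<nabla>f\<close> and produces \<open>\<Delta>f = 0\<close>.
\<close>

lemma integral_bump_harmonic:
  fixes f :: "real^'n::finite \<Rightarrow> real"
  assumes S: "open S" "cball y r \<subseteq> S" "r \<ge> 0"
    and f: "\<And>x. x \<in> S \<Longrightarrow> (f has_derivative (\<lambda>v. \<Sum>i\<in>UNIV. D i x * v $ i)) (at x)"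
    and D: "\<And>i x. x \<in> S \<Longrightarrow> (D i has_derivative D' i x) (at x)"
    and cont: "\<And>i. continuous_on S (\<lambda>x. D' i x (axis i 1))"
    and harm: "\<And>x. x \<in> S \<Longrightarrow> (\<Sum>i\<in>UNIV. D' i x (axis i 1)) = 0"
  shows "(LINT x|lborel. bump x * f (y + r *\<^sub>R x)) = f y * (LINT x|lborel. bump (x::real^'n))"
proof -
  obtain b :: "real^'n" where b: "cball 0 1 \<subseteq> cbox (-b) b"
    using bounded_subset_cbox_symmetric[OF bounded_cball] by metis
  have inS: "y + t *\<^sub>R x \<in> S" if "t \<in> {0..r}" "norm x \<le> 1" for t x
  proof -
    have "\<bar>t\<bar> * norm x \<le> r * 1" using that by (intro mult_mono) auto
    then show ?thesis using S by (auto simp: dist_norm)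
  qed
  have contf: "continuous_on S f" and contD: "continuous_on S (D i)" for i
    using f D by (auto intro!: continuous_at_imp_continuous_on has_derivative_continuous)
  have eq: "integral (cbox (-b) b) (\<lambda>x. bump x * g x) = (LINT x|lborel. bump x * g x)"
    if "continuous_on (cball 0 1) g" for g
  proof -
    have int: "integrable lborel (\<lambda>x. bump x * g x)" by (rule integrable_bump_mult[OF that])
    have "integral (cbox (-b) b) (\<lambda>x. bump x * g x) = (LINT x:cbox (-b) b|lborel. bump x * g x)"
      using integrable_mult_indicator[OF _ int, of "cbox (-b) b"]
      by (intro set_borel_integral_eq_integral(2)[symmetric]) (simp add: set_integrable_def)
    also have "\<dots> = (LINT x|lborel. bump x * g x)"
      unfolding set_lebesgue_integral_def
    proof (intro Bochner_Integration.integral_cong refl)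
      show "indicator (cbox (-b) b) x *\<^sub>R (bump x * g x) = bump x * g x" for x
        using b by (cases "norm x \<le> 1") (auto simp: bump_eq_0)
    qed
    finally show ?thesis .
  qed
  \<comment> \<open>The \<open>t\<close>-derivative of
    \<open>bump x * f (y + t *\<^sub>R x)\<close>, by the chain rule.\<close>
  define G where "G t x = (\<Sum>i\<in>UNIV. bump x * (x $ i * D i (y + t *\<^sub>R x)))" for t x
  have contc: "continuous_on (cball 0 1) (\<lambda>x. g (y + t *\<^sub>R x))"
    if "continuous_on S g" "t \<in> {0..r}" for t and g :: "real^'n \<Rightarrow> real"
    by (intro continuous_on_compose2[OF that(1)] continuous_intros) (auto intro!: inS that(2))
  have contU: "continuous_on UNIV (\<lambda>x. bump x * (c x * g (y + t *\<^sub>R x)))"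
    if "continuous_on S g" "t \<in> {0..r}" "continuous_on UNIV c" for t and g c :: "real^'n \<Rightarrow> real"
    \<comment> \<open>The two closed sets cover the space and overlap in the unit sphere, where the
      weight already vanishes.\<close>
    by (rule continuous_on_mult_supported[where B = "cball 0 1" and C = "- ball 0 1"])
       (auto intro!: continuous_intros bump_eq_0 contc that continuous_on_subset[OF that(3)])
  have zero: "(LINT x|lborel. G t x) = 0" if t: "t \<in> {0..r}" for t
  proof -
    \<comment> \<open>The product rule for
      \<open>(bump x)\<^sup>2 * D i (y + t *\<^sub>R x)\<close>. Along \<open>axis i 1\<close> it
      splits into \<open>P i\<close>, which carries a second derivative of \<open>f\<close>, and -4
      times the \<open>i\<close>-th summand of \<open>G t\<close>. The left side integrates to 0,
      and the \<open>P i\<close> add up to a multiple of the Laplacian of \<open>f\<close>, so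
      \<open>G t\<close> integrates to 0.\<close>
    define L where "L i x = (\<lambda>v. (bump x)\<^sup>2 * (t * D' i (y + t *\<^sub>R x) v) 
        + (- 4 * bump x * (x \<bullet> v)) * D i (y + t *\<^sub>R x))" for i x
    define P where "P i x = bump x * (bump x * t * D' i (y + t *\<^sub>R x) (axis i 1))" for i x
    have L_eq: "L i x (axis i 1) = P i x - 4 * (bump x * (x $ i * D i (y + t *\<^sub>R x)))" for i x
      by (simp add: L_def P_def power2_eq_square inner_axis algebra_simps)
    have L0: "(LINT x|lborel. L i x (axis i 1)) = 0" for i
    proof (rule integral_derivative_eq_0[where F = "\<lambda>x. (bump x)\<^sup>2 * D i (y + t *\<^sub>R x)"])
      fix x
      show "((\<lambda>x. (bump x)\<^sup>2 * D i (y + t *\<^sub>R x)) has_derivative L i x) (at x)"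
      proof (cases "norm x \<le> 1")
        case True
        then have "y + t *\<^sub>R x \<in> S" using inS t by blast
        from D[OF this] have lin: "linear (D' i (y + t *\<^sub>R x))"
          and der: "(D i has_derivative D' i (y + t *\<^sub>R x)) (at (y + t *\<^sub>R x))"
          by (auto intro: has_derivative_linear)
        have "((\<lambda>x. D i (y + t *\<^sub>R x)) has_derivative (\<lambda>v. D' i (y + t *\<^sub>R x) (t *\<^sub>R v))) (at x)"
          by (rule has_derivative_compose[where f = "\<lambda>x. y + t *\<^sub>R x", OF _ der]) (auto intro!: derivative_eq_intros)
        from has_derivative_mult[OF has_derivative_bump_power2 this] show ?thesis
          using lin by (simp add: L_def linear_cmul)
      next
        case False
        \<comment> \<open>Off the closed unit ball the product is locally zero, even where nothing
          is known about \<open>D i\<close>.\<close>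
        have "((\<lambda>x. 0) has_derivative (\<lambda>v. 0)) (at x)" by simp
        then have "((\<lambda>x. (bump x)\<^sup>2 * D i (y + t *\<^sub>R x)) has_derivative (\<lambda>v. 0)) (at x)"
          by (rule has_derivative_transform_within_open[of _ _ _ _ "- cball 0 1"])
             (use False in \<open>auto simp: bump_eq_0\<close>)
        then show ?thesis using False by (simp add: L_def bump_eq_0)
      qed
    next
      show "continuous_on UNIV (\<lambda>x. L i x (axis i 1))"
        unfolding L_eq P_def
        by (intro continuous_on_diff continuous_on_mult_left contU cont contD t continuous_intros)
    qed (auto simp: L_def bump_eq_0)
    have intD: "integrable lborel (\<lambda>x. bump x * (x $ i * D i (y + t *\<^sub>R x)))" for i
      using t by (intro integrable_bump_mult continuous_intros contc contD)
    have intP: "integrable lborel (P i)" for i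
      unfolding P_def using t by (intro integrable_bump_mult continuous_intros contc[OF cont])
    have P0: "(\<Sum>i\<in>UNIV. P i x) = 0" for x
    proof (cases "norm x \<le> 1")
      case True
      then have "(\<Sum>i\<in>UNIV. D' i (y + t *\<^sub>R x) (axis i 1)) = 0" using t by (intro harm inS)
      then show ?thesis by (simp add: P_def sum_distrib_left[symmetric])
    qed (simp add: P_def bump_eq_0)
    have "(LINT x|lborel. P i x) = 4 * (LINT x|lborel. bump x * (x $ i * D i (y + t *\<^sub>R x)))" for i
      using L0[of i] intP intD unfolding L_eq by simp
    then have "4 * (LINT x|lborel. G t x) = (\<Sum>i\<in>UNIV. LINT x|lborel. P i x)"
      unfolding G_def using intD by (simp add: sum_distrib_left)
    also have "\<dots> = (LINT x|lborel. (\<Sum>i\<in>UNIV. P i x))" using intP by simp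
    finally show ?thesis by (simp add: P0)
  qed
  have "((\<lambda>t. integral (cbox (-b) b) (\<lambda>x. bump x * f (y + t *\<^sub>R x))) has_real_derivative 0)
     (at t within {0..r})" if t: "t \<in> {0..r}" for t
  proof -
    have "((\<lambda>t. integral (cbox (-b) b) (\<lambda>x. bump x * f (y + t *\<^sub>R x))) has_real_derivative
       integral (cbox (-b) b) (G t)) (at t within {0..r})"
    proof (rule leibniz_rule_field_derivative)
      fix t x assume t: "t \<in> {0..r}"
      show "((\<lambda>t. bump x * f (y + t *\<^sub>R x)) has_real_derivative G t x) (at t within {0..r})"
      proof (cases "norm x \<le> 1")
        case True
        have "((\<lambda>t. f (y + t *\<^sub>R x)) has_derivative
           (\<lambda>s. \<Sum>i\<in>UNIV. D i (y + t *\<^sub>R x) * (s *\<^sub>R x) $ i)) (at t within {0..r})"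
          using inS[OF t True] by (intro has_derivative_compose[OF _ f, where f = "\<lambda>t. y + t *\<^sub>R x"])
            (auto intro!: derivative_eq_intros)
        also have "(\<lambda>s. \<Sum>i\<in>UNIV. D i (y + t *\<^sub>R x) * (s *\<^sub>R x) $ i)
            = (*) (\<Sum>i\<in>UNIV. D i (y + t *\<^sub>R x) * x $ i)"
          by (auto simp: sum_distrib_left sum_distrib_right mult_ac)
        finally have "((\<lambda>t. f (y + t *\<^sub>R x)) has_real_derivative
            (\<Sum>i\<in>UNIV. D i (y + t *\<^sub>R x) * x $ i)) (at t within {0..r})"
          by (simp add: has_field_derivative_def)
        from DERIV_cmult[OF this, of "bump x"] show ?thesis
          by (simp add: G_def sum_distrib_left mult_ac)
      qed (simp add: G_def bump_eq_0)
    next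
      fix t assume t: "t \<in> {0..r}"
      have "continuous_on (cbox (-b) b) (\<lambda>x. bump x * (1 * f (y + t *\<^sub>R x)))"
        by (rule continuous_on_subset[OF contU]) (use t in \<open>auto simp: contf\<close>)
      then show "(\<lambda>x. bump x * f (y + t *\<^sub>R x)) integrable_on cbox (-b) b"
        by (intro integrable_continuous) simp
    next
      have "continuous_on ({0..r} \<times> cbox (-b) b)
          (\<lambda>z. bump (snd z) * (snd z $ i * D i (y + fst z *\<^sub>R snd z)))" for i
      proof (rule continuous_on_mult_supported[where B = "UNIV \<times> cball 0 1" and C = "UNIV \<times> - ball 0 1"])
        show "continuous_on ({0..r} \<times> cbox (- b) b \<inter> UNIV \<times> cball 0 1)
           (\<lambda>z. snd z $ i * D i (y + fst z *\<^sub>R snd z))"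
          by (intro continuous_intros continuous_on_compose2[OF contD]) (auto intro!: inS)
      qed (auto intro!: closed_Times continuous_intros bump_eq_0 simp: closed_Compl)
      then show "continuous_on ({0..r} \<times> cbox (-b) b) (\<lambda>(t, x). G t x)"
        unfolding G_def case_prod_unfold by (intro continuous_on_sum)
    qed (use t in auto)
    moreover have "integral (cbox (-b) b) (G t) = (LINT x|lborel. G t x)"
      unfolding G_def sum_distrib_left[symmetric] using t
      by (intro eq continuous_intros contc contD)
    ultimately show ?thesis using zero[OF t] by simp
  qed
  then have "\<exists>c. \<forall>t\<in>{0..r}. integral (cbox (-b) b) (\<lambda>x. bump x * f (y + t *\<^sub>R x)) = c"
    by (intro has_field_derivative_zero_constant convex_real_interval)
  then obtain c where c: "\<And>t. t \<in> {0..r} \<Longrightarrow> integral (cbox (-b) b) (\<lambda>x. bump x * f (y + t *\<^sub>R x)) = c"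
    by blast
  have "(LINT x|lborel. bump x * f (y + t *\<^sub>R x)) = c" if "t \<in> {0..r}" for t
    using c[OF that] eq[OF contc[OF contf that]] by simp
  \<comment> \<open>At \<open>t = 0\<close> the constant value is \<open>f y\<close> times the mass
    of the weight.\<close>
  from this[of r] this[of 0] show ?thesis using S(3) by (simp add: mult.commute)
qed

section \<open>Boundary growth of the torsion function\<close>

text \<open>If \<open>l\<close> were negative, \<open>g'\<close>, being 0 at the minimum, would be
  negative just to the right of 0, and the mean value theorem would push \<open>g\<close> below
  \<open>g 0\<close>.\<close>

lemma local_min_second_derivative_nonneg:
  fixes g g' :: "real \<Rightarrow> real"
  assumes \<delta>: "\<delta> > 0"
    and g: "\<And>t. \<bar>t\<bar> < \<delta> \<Longrightarrow> (g has_real_derivative g' t) (at t)"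
    and g': "(g' has_real_derivative l) (at 0)"
    and min: "\<And>t. \<bar>t\<bar> < \<delta> \<Longrightarrow> g 0 \<le> g t"
  shows "0 \<le> l"
proof (rule ccontr)
  assume "\<not> 0 \<le> l"
  then obtain d where d: "d > 0" "\<And>h. 0 < h \<Longrightarrow> h < d \<Longrightarrow> g' h < g' 0"
    using DERIV_neg_dec_right[OF g'] by auto
  have "g' 0 = 0"
    using DERIV_local_min[OF g[of 0] \<delta>] \<delta> min by simp
  define t where "t = min d \<delta> / 2"
  have t: "0 < t" "t < d" "t < \<delta>" using d(1) \<delta> by (auto simp: t_def)
  obtain z where z: "0 < z" "z < t" "g t - g 0 = (t - 0) * g' z"
    using MVT2[of 0 t g g'] t g by auto
  have "t * g' z < 0" using d(2)[of z] z t \<open>g' 0 = 0\<close> by (simp add: mult_pos_neg)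
  then show False using z(3) min[of t] t by simp
qed

text \<open>At an interior minimum every \<open>l i x\<close> would be nonnegative, against their
  negative sum; so the minimum over the closure lies on the frontier. Asking for derivatives along
  coordinate lines only reduces the treatment of a barrier to one-variable calculus.\<close>

lemma second_derivative_minimum_principle:
  fixes v :: "real^'n::finite \<Rightarrow> real"
  assumes \<Omega>: "bounded \<Omega>" "open \<Omega>" and cont: "continuous_on (closure \<Omega>) v"
    and der: "\<And>x i. x \<in> \<Omega> \<Longrightarrow> \<exists>\<delta>>0. \<exists>g'.
        (\<forall>t. \<bar>t\<bar> < \<delta> \<longrightarrow> ((\<lambda>t. v (x + t *\<^sub>R axis i 1)) has_real_derivative g' t) (at t)) \<and>
        (g' has_real_derivative l i x) (at 0)"
    and neg: "\<And>x. x \<in> \<Omega> \<Longrightarrow> (\<Sum>i\<in>UNIV. l i x) < 0"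
    and bd: "\<And>x. x \<in> frontier \<Omega> \<Longrightarrow> 0 \<le> v x"
    and y: "y \<in> \<Omega>"
  shows "0 \<le> v y"
proof -
  have "compact (closure \<Omega>)" "closure \<Omega> \<noteq> {}" using \<Omega> y closure_subset by (auto simp: compact_closure)
  then obtain x where x: "x \<in> closure \<Omega>" "\<And>z. z \<in> closure \<Omega> \<Longrightarrow> v x \<le> v z"
    using continuous_attains_inf[OF _ _ cont] by blast
  have "x \<notin> \<Omega>"
  proof
    assume x\<Omega>: "x \<in> \<Omega>"
    then obtain e where e: "e > 0" "ball x e \<subseteq> \<Omega>" using \<Omega>(2) by (auto simp: open_contains_ball)
    have "0 \<le> l i x" for i
    proof -
      obtain \<delta> g' where g': "\<delta> > 0"
        "\<And>t. \<bar>t\<bar> < \<delta> \<Longrightarrow> ((\<lambda>t. v (x + t *\<^sub>R axis i 1)) has_real_derivative g' t) (at t)"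
        "(g' has_real_derivative l i x) (at 0)"
        using der[OF x\<Omega>, of i] by blast
      show ?thesis
      proof (rule local_min_second_derivative_nonneg[where \<delta> = "min \<delta> e", OF _ _ g'(3)])
        fix t :: real assume "\<bar>t\<bar> < min \<delta> e"
        then have "x + t *\<^sub>R axis i 1 \<in> \<Omega>" using e by (auto simp: subset_iff dist_norm)
        then show "v (x + 0 *\<^sub>R axis i 1) \<le> v (x + t *\<^sub>R axis i 1)"
          using x(2) closure_subset by auto
      qed (use g' e in auto)
    qed
    then have "0 \<le> (\<Sum>i\<in>UNIV. l i x)" by (simp add: sum_nonneg)
    with neg[OF x\<Omega>] show False by simp
  qed
  then have "x \<in> frontier \<Omega>" using x(1) \<Omega>(2) by (simp add: frontier_def interior_open)
  from bd[OF this] x(2)[of y] y closure_subset show ?thesis by force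
qed

section \<open>Derivatives along coordinate lines and the sign of torsion solutions\<close>

lemma partial_deriv_has_real_derivative:
  assumes "f differentiable (at (x + t *\<^sub>R axis i 1))"
  shows "((\<lambda>t. f (x + t *\<^sub>R axis i 1)) has_real_derivative partial_deriv i f (x + t *\<^sub>R axis i 1)) (at t)"
proof -
  let ?x = "x + t *\<^sub>R axis i 1"
  have f: "(f has_derivative frechet_derivative f (at ?x)) (at ?x)"
    using assms frechet_derivative_works by blast
  have "((\<lambda>t. f (x + t *\<^sub>R axis i 1)) has_derivative
      (\<lambda>s. frechet_derivative f (at ?x) (s *\<^sub>R axis i 1))) (at t)"
    by (rule has_derivative_compose[where f = "\<lambda>t. x + t *\<^sub>R axis i 1", OF _ f])
       (auto intro!: derivative_eq_intros)
  then show ?thesis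
    using f by (simp add: has_field_derivative_def partial_deriv_def mult_commute_abs
        has_derivative_linear linear_cmul)
qed

text \<open>This supplies the hypothesis \<open>der\<close> of the minimum principle;
  \<open>\<delta>\<close> is the radius of a ball around \<open>x\<close> inside the open
  set.\<close>

lemma C2_on_line_derivatives:
  assumes "C2_on \<Omega> u" "open \<Omega>" "x \<in> \<Omega>"
  obtains \<delta> where "\<delta> > 0"
    "\<And>t. \<bar>t\<bar> < \<delta> \<Longrightarrow> ((\<lambda>t. u (x + t *\<^sub>R axis i 1)) has_real_derivative
        partial_deriv i u (x + t *\<^sub>R axis i 1)) (at t)"
    "((\<lambda>t. partial_deriv i u (x + t *\<^sub>R axis i 1)) has_real_derivative
        partial_deriv i (partial_deriv i u) x) (at 0)"
proof -
  obtain e where e: "e > 0" "ball x e \<subseteq> \<Omega>" using assms by (auto simp: open_contains_ball)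
  show ?thesis
  proof
    show "((\<lambda>t. u (x + t *\<^sub>R axis i 1)) has_real_derivative
        partial_deriv i u (x + t *\<^sub>R axis i 1)) (at t)" if "\<bar>t\<bar> < e" for t
    proof (rule partial_deriv_has_real_derivative)
      have "x + t *\<^sub>R axis i 1 \<in> \<Omega>" using e that by (auto simp: subset_iff dist_norm)
      then show "u differentiable (at (x + t *\<^sub>R axis i 1))" using assms(1) by (simp add: C2_on_def)
    qed
    show "((\<lambda>t. partial_deriv i u (x + t *\<^sub>R axis i 1)) has_real_derivative
        partial_deriv i (partial_deriv i u) x) (at 0)"
      using partial_deriv_has_real_derivative[of "partial_deriv i u" x 0 i] assms
      by (simp add: C2_on_def)
  qed (fact e)
qed

text \<open>The minimum principle applies to \<open>-u\<close>, whose Laplacian is -N < 0 and whose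
  boundary values are 0.\<close>

lemma torsion_solution_nonpos:
  fixes \<Omega> :: "(real^'n::finite) set"
  assumes \<Omega>: "bounded \<Omega>" "open \<Omega>" and u: "torsion_solution \<Omega> u" and y: "y \<in> \<Omega>"
  shows "u y \<le> 0"
proof -
  have "0 \<le> - u y"
  proof (rule second_derivative_minimum_principle[OF \<Omega> _ _ _ _ y,
        where l = "\<lambda>i x. - partial_deriv i (partial_deriv i u) x"])
    show "continuous_on (closure \<Omega>) (\<lambda>y. - u y)"
      using u by (auto simp: torsion_solution_def intro: continuous_intros)
    fix x assume x: "x \<in> \<Omega>"
    show "\<exists>\<delta>>0. \<exists>g'. (\<forall>t. \<bar>t\<bar> < \<delta> \<longrightarrow> ((\<lambda>t. - u (x + t *\<^sub>R axis i 1)) has_real_derivative g' t) (at t)) \<and>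
        (g' has_real_derivative - partial_deriv i (partial_deriv i u) x) (at 0)" for i
    proof -
      have "C2_on \<Omega> u" using u by (simp add: torsion_solution_def)
      from C2_on_line_derivatives[OF this \<Omega>(2) x, of i] show ?thesis
        by (metis DERIV_minus)
    qed
    show "(\<Sum>i\<in>UNIV. - partial_deriv i (partial_deriv i u) x) < 0"
      using u x by (simp add: torsion_solution_def laplacian_def sum_negf)
  next
    show "0 \<le> - u x" if "x \<in> frontier \<Omega>" for x using u that by (simp add: torsion_solution_def)
  qed
  then show ?thesis by simp
qed

text \<open>
  The barrier is \<open>w(z) = A (exp(-\<alpha> r\<^sup>2) - exp(-\<alpha> |z - c|\<^sup>2))\<close>, where \<open>\<alpha>\<close> makes it strictly
  superharmonic outside the exterior ball and \<open>A\<close> makes \<open>\<Delta>w \<le> -2N\<close> on the domain.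
\<close>

lemma torsion_solution_boundary_growth:
  fixes \<Omega> :: "(real^'n::finite) set"
  assumes \<Omega>: "bounded \<Omega>" "open \<Omega>" "exterior_sphere \<Omega> r" and u: "torsion_solution \<Omega> u"
    and x: "x \<in> frontier \<Omega>" and y: "y \<in> \<Omega>"
  shows "\<bar>u y\<bar> \<le> exp (CARD('n) / r\<^sup>2 * (r + diameter \<Omega>)\<^sup>2) * (2 * r + diameter \<Omega>) * norm (y - x)"
proof -
  define d where "d = diameter \<Omega>"
  \<comment> \<open>With this value, |z - c| \<ge> r gives 4 \<alpha> |z - c|^2 \<ge> 4N, so the
    bracket in the Laplacian of the barrier is at most -2N.\<close>
  define \<alpha> where "\<alpha> = CARD('n) / r\<^sup>2"
  \<comment> \<open>Chosen so that \<open>A * \<alpha> * exp (- \<alpha> * (r + d)\<^sup>2)\<close>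
    is 1. As |z - c| \<le> r + d on the closure, the factor in front of that bracket is then at
    least 1.\<close>
  define A where "A = exp (\<alpha> * (r + d)\<^sup>2) / \<alpha>"
  obtain c where r: "r > 0" and c: "ball c r \<subseteq> - closure \<Omega>" "closure (ball c r) \<inter> frontier \<Omega> = {x}"
    using \<Omega>(3) x by (auto simp: exterior_sphere_def)
  have \<alpha>: "\<alpha> > 0" and A: "A > 0" using r by (auto simp: \<alpha>_def A_def)
  have "x \<in> cball c r" using c(2) r by auto
  then have xc: "norm (x - c) \<le> r" by (simp add: dist_norm norm_minus_commute)
  have out: "r \<le> norm (z - c)" if "z \<in> closure \<Omega>" for z
    
  proof -
    have "z \<notin> ball c r" using c(1) that by blast
    then show ?thesis by (simp add: dist_norm norm_minus_commute)
  qed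
  have x\<Omega>: "x \<in> closure \<Omega>" using x by (simp add: frontier_def)
  have diam: "norm (z - x) \<le> d" if "z \<in> closure \<Omega>" for z
    using diameter_bounded_bound[of "closure \<Omega>" z x] that x\<Omega> \<Omega>
    by (simp add: d_def diameter_closure bounded_closure dist_norm)
  have near: "norm (z - c) \<le> r + norm (z - x)" for z
    using norm_triangle_ineq[of "z - x" "x - c"] xc by simp
  define w where "w = (\<lambda>z. A * (exp (- \<alpha> * r\<^sup>2) - exp (- \<alpha> * ((z - c) \<bullet> (z - c)))))"
  define l where "l = (\<lambda>i z. A * \<alpha> * (2 - 4 * \<alpha> * ((z - c) $ i)\<^sup>2) * exp (- \<alpha> * ((z - c) \<bullet> (z - c))))"
  \<comment> \<open>The sum has Laplacian at most N - 2N < 0 and is nonnegative on the frontier,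
    where \<open>u\<close> vanishes and |z - c| \<ge> r. This gives -u \<le> w.\<close>
  have "0 \<le> u y + w y"
  proof (rule second_derivative_minimum_principle[OF \<Omega>(1,2) _ _ _ _ y,
        where l = "\<lambda>i x. partial_deriv i (partial_deriv i u) x + l i x"])
    show "continuous_on (closure \<Omega>) (\<lambda>y. u y + w y)"
      using u unfolding w_def by (auto simp: torsion_solution_def intro!: continuous_intros)
    fix z assume z: "z \<in> \<Omega>"
    show "\<exists>\<delta>>0. \<exists>g'. (\<forall>t. \<bar>t\<bar> < \<delta> \<longrightarrow>
        ((\<lambda>t. u (z + t *\<^sub>R axis i 1) + w (z + t *\<^sub>R axis i 1)) has_real_derivative g' t) (at t)) \<and>
        (g' has_real_derivative partial_deriv i (partial_deriv i u) z + l i z) (at 0)" for i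
    proof -
      \<comment> \<open>The exponential of the barrier restricted to the line through
        \<open>z\<close> in direction \<open>axis i 1\<close>, with the square expanded in
        \<open>t\<close>.\<close>
      define E where "E t = exp (- \<alpha> * ((z - c) \<bullet> (z - c) + 2 * t * (z - c) $ i + t\<^sup>2))" for t
      have w_line: "w (z + t *\<^sub>R axis i 1) = A * (exp (- \<alpha> * r\<^sup>2) - E t)" for t
      proof -
        have "(z + t *\<^sub>R axis i 1 - c) \<bullet> (z + t *\<^sub>R axis i 1 - c)
           = ((z - c) + t *\<^sub>R axis i 1) \<bullet> ((z - c) + t *\<^sub>R axis i 1)" by (simp add: algebra_simps)
        also have "\<dots> = (z - c) \<bullet> (z - c) + 2 * t * (z - c) $ i + t\<^sup>2"
          unfolding inner_add_left inner_add_right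
          by (simp add: inner_axis inner_axis' inner_axis_axis power2_eq_square)
        finally show ?thesis by (simp add: w_def E_def)
      qed
      have E1: "((\<lambda>t. w (z + t *\<^sub>R axis i 1)) has_real_derivative
          A * \<alpha> * (2 * (z - c) $ i + 2 * t) * E t) (at t)" for t
        unfolding w_line unfolding E_def
        by (auto intro!: derivative_eq_intros simp: algebra_simps)
      have E2: "((\<lambda>t. A * \<alpha> * (2 * (z - c) $ i + 2 * t) * E t) has_real_derivative l i z) (at 0)"
        unfolding E_def l_def
        by (auto intro!: derivative_eq_intros simp: algebra_simps power2_eq_square)
      have "C2_on \<Omega> u" using u by (simp add: torsion_solution_def)
      from C2_on_line_derivatives[OF this \<Omega>(2) z, of i] obtain \<delta> where "\<delta> > 0"
        "\<And>t. \<bar>t\<bar> < \<delta> \<Longrightarrow> ((\<lambda>t. u (z + t *\<^sub>R axis i 1)) has_real_derivative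
          partial_deriv i u (z + t *\<^sub>R axis i 1)) (at t)"
        "((\<lambda>t. partial_deriv i u (z + t *\<^sub>R axis i 1)) has_real_derivative
          partial_deriv i (partial_deriv i u) z) (at 0)" by blast
      from this(1) DERIV_add[OF this(2) E1] DERIV_add[OF this(3) E2] show ?thesis
        by (intro exI[of _ \<delta>] exI conjI allI impI) assumption+
    qed
    have "(\<Sum>i\<in>UNIV. l i z)
        = A * \<alpha> * (2 * real CARD('n) - 4 * \<alpha> * (norm (z - c))\<^sup>2) * exp (- \<alpha> * (norm (z - c))\<^sup>2)"
    proof -
      have "(norm (z - c))\<^sup>2 = (\<Sum>i\<in>UNIV. ((z - c) $ i)\<^sup>2)"
        by (simp add: norm_vec_def L2_set_def sum_nonneg)
      then show ?thesis
        unfolding l_def dot_square_norm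
        by (simp add: sum_distrib_left[symmetric] sum_distrib_right[symmetric] sum_subtractf)
    qed
    also have "\<dots> \<le> - 2 * real CARD('n)"
    proof -
      have zcl: "z \<in> closure \<Omega>" using z closure_subset by blast
      have "r\<^sup>2 \<le> (norm (z - c))\<^sup>2" using out[OF zcl] r by (intro power_mono) auto
      then have "\<alpha> * r\<^sup>2 \<le> \<alpha> * (norm (z - c))\<^sup>2" using \<alpha> by simp
      then have 1: "2 * real CARD('n) - 4 * \<alpha> * (norm (z - c))\<^sup>2 \<le> - 2 * real CARD('n)"
        using r by (simp add: \<alpha>_def)
      have "(norm (z - c))\<^sup>2 \<le> (r + d)\<^sup>2"
        using near[of z] diam[OF zcl] by (intro power_mono) auto
      then have "exp (- \<alpha> * (r + d)\<^sup>2) \<le> exp (- \<alpha> * (norm (z - c))\<^sup>2)" using \<alpha> by simp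
      then have "A * \<alpha> * exp (- \<alpha> * (r + d)\<^sup>2) \<le> A * \<alpha> * exp (- \<alpha> * (norm (z - c))\<^sup>2)"
        using A \<alpha> by simp
      moreover have "A * \<alpha> * exp (- \<alpha> * (r + d)\<^sup>2) = 1"
        using \<alpha> by (simp add: A_def exp_minus)
      ultimately have 2: "1 \<le> A * \<alpha> * exp (- \<alpha> * (norm (z - c))\<^sup>2)" by simp
      have "(A * \<alpha> * exp (- \<alpha> * (norm (z - c))\<^sup>2)) * (2 * real CARD('n) - 4 * \<alpha> * (norm (z - c))\<^sup>2)
         \<le> (A * \<alpha> * exp (- \<alpha> * (norm (z - c))\<^sup>2)) * (- 2 * real CARD('n))"
        using 1 2 by (intro mult_left_mono) auto
      also have "\<dots> \<le> 1 * (- 2 * real CARD('n))" using 2 by (intro mult_right_mono_neg) auto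
      finally show ?thesis by (simp add: mult_ac)
    qed
    finally have "(\<Sum>i\<in>UNIV. l i z) < - real CARD('n)" by (simp add: order.strict_trans1)
    then show "(\<Sum>i\<in>UNIV. partial_deriv i (partial_deriv i u) z + l i z) < 0"
      using u z by (simp add: torsion_solution_def laplacian_def sum.distrib)
  next
    fix z assume z: "z \<in> frontier \<Omega>"
    then have "r\<^sup>2 \<le> (norm (z - c))\<^sup>2" using out[of z] r
      by (intro power_mono) (auto simp: frontier_def)
    then have "0 \<le> w z" using \<alpha> A by (simp add: w_def dot_square_norm)
    then show "0 \<le> u z + w z" using u z by (simp add: torsion_solution_def)
  qed
  moreover have "w y \<le> exp (\<alpha> * (r + d)\<^sup>2) * (2 * r + d) * norm (y - x)"
  proof -
    have ycl: "y \<in> closure \<Omega>" using y closure_subset by blast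
    \<comment> \<open>The barrier is at most linear in \<open>\<tau>\<close> by
      \<open>1 - exp (-s) \<le> s\<close>. Factored as a difference of squares,
      \<open>\<tau>\<close> is at most a constant times the distance to \<open>x\<close>, because
      \<open>x\<close> lies in the closed exterior ball.\<close>
    define \<tau> where "\<tau> = (norm (y - c))\<^sup>2 - r\<^sup>2"
    have "exp (- \<alpha> * (norm (y - c))\<^sup>2) = exp (- \<alpha> * r\<^sup>2) * exp (- \<alpha> * \<tau>)"
      by (simp add: \<tau>_def mult_exp_exp algebra_simps)
    then have "w y = A * (exp (- \<alpha> * r\<^sup>2) * (1 - exp (- \<alpha> * \<tau>)))"
      by (simp add: w_def dot_square_norm algebra_simps)
    also have "\<dots> \<le> A * (1 * (\<alpha> * \<tau>))"
    proof -
      have "0 \<le> \<tau>" using out[OF ycl] r by (simp add: \<tau>_def)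
      then have "0 \<le> \<alpha> * \<tau>" using \<alpha> by simp
      moreover have "1 - exp (- \<alpha> * \<tau>) \<le> \<alpha> * \<tau>" using exp_ge_add_one_self[of "- \<alpha> * \<tau>"] by simp
      ultimately have "exp (- \<alpha> * r\<^sup>2) * (1 - exp (- \<alpha> * \<tau>)) \<le> 1 * (\<alpha> * \<tau>)"
        using \<alpha> by (intro mult_mono) auto
      then show ?thesis using A by simp
    qed
    also have "\<dots> = exp (\<alpha> * (r + d)\<^sup>2) * \<tau>" using \<alpha> by (simp add: A_def)
    also have "\<tau> \<le> (2 * r + d) * norm (y - x)"
    proof -
      have "\<tau> = (norm (y - c) + r) * (norm (y - c) - r)"
        by (simp add: \<tau>_def power2_eq_square algebra_simps)
      also have "\<dots> \<le> (2 * r + d) * norm (y - x)"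
        using near[of y] diam[OF ycl] out[OF ycl] r by (intro mult_mono) auto
      finally show ?thesis .
    qed
    finally show ?thesis by (simp add: mult.assoc)
  qed
  moreover have "u y \<le> 0" using torsion_solution_nonpos[OF \<Omega>(1,2) u y] .
  ultimately show ?thesis by (simp add: \<alpha>_def d_def)
qed

section \<open>The deviation at the boundary\<close>

text \<open>When |a| exceeds \<open>s\<close>, the nonpositive exponent \<open>1 - p\<close> gives
  \<open>\<bar>a\<bar> powr (1 - p) \<le> s powr (1 - p)\<close>. The threshold \<open>s\<close>
  stays free, to be balanced later.\<close>

lemma abs_le_add_powr:
  fixes a s p :: real
  assumes "0 < s" "1 \<le> p"
  shows "\<bar>a\<bar> \<le> s + s powr (1 - p) * \<bar>a\<bar> powr p"
proof (cases "\<bar>a\<bar> \<le> s")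
  case True
  then show ?thesis by (simp add: add_increasing2)
next
  case False
  then have "\<bar>a\<bar> = \<bar>a\<bar> powr (1 - p) * \<bar>a\<bar> powr p"
    using assms by (simp add: powr_add[symmetric])
  also have "\<dots> \<le> s powr (1 - p) * \<bar>a\<bar> powr p"
    using False assms by (intro mult_right_mono powr_mono2') auto
  finally show ?thesis using assms by simp
qed

lemma lborel_integral_affine:
  fixes F :: "'a::euclidean_space \<Rightarrow> real"
  assumes [measurable]: "F \<in> borel_measurable borel" and "c > 0"
  shows "(LINT x|lborel. F (t + c *\<^sub>R x)) = (LINT x|lborel. F x) / c ^ DIM('a)"
proof -
  have "(LINT x|lborel. F x)
      = (LINT x|density (distr lborel borel (\<lambda>x. t + c *\<^sub>R x)) (\<lambda>_. \<bar>c\<bar> ^ DIM('a)). F x)"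
    using lborel_affine[of c t] assms(2) by simp
  also have "\<dots> = (LINT x|distr lborel borel (\<lambda>x. t + c *\<^sub>R x). c ^ DIM('a) * F x)"
    using assms(2) by (subst integral_density) auto
  also have "\<dots> = (LINT x|lborel. c ^ DIM('a) * F (t + c *\<^sub>R x))"
    by (subst integral_distr) auto
  finally show ?thesis using assms(2) by simp
qed

lemma lborel_integrable_affine:
  fixes F :: "'a::euclidean_space \<Rightarrow> real"
  assumes F: "integrable lborel F" and "c > 0"
  shows "integrable lborel (\<lambda>x. F (t + c *\<^sub>R x))"
proof -
  have [measurable]: "F \<in> borel_measurable borel" using F by (auto dest: borel_measurable_integrable)
  have "integrable (density (distr lborel borel (\<lambda>x. t + c *\<^sub>R x)) (\<lambda>_. \<bar>c\<bar> ^ DIM('a))) F"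
    using lborel_affine[of c t] assms by simp
  then have "integrable (distr lborel borel (\<lambda>x. t + c *\<^sub>R x)) (\<lambda>x. c ^ DIM('a) * F x)"
    using assms(2) by (subst (asm) integrable_density) auto
  then have "integrable lborel (\<lambda>x. c ^ DIM('a) * F (t + c *\<^sub>R x))"
    by (subst (asm) integrable_distr_eq) auto
  then show ?thesis using assms(2) by simp
qed

text \<open>The deviation at \<open>y\<close> is a weighted mean of deviations over the ball of
  radius \<open>\<sigma>\<close>; splitting each at the threshold \<open>s\<close> and rescaling the
  power term back to that ball yields the factor \<open>1 / \<sigma> ^ CARD('n)\<close>.\<close>

lemma interior_deviation_le:
  fixes f :: "real^'n::finite \<Rightarrow> real" and c p s :: real
  assumes p: "1 \<le> p" and S: "open S" "cball y \<sigma> \<subseteq> S" "\<sigma> > 0" and s: "s > 0"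
    and int: "set_integrable lborel S (\<lambda>x. \<bar>f x - c\<bar> powr p)"
    and f: "\<And>x. x \<in> S \<Longrightarrow> (f has_derivative (\<lambda>v. \<Sum>i\<in>UNIV. D i x * v $ i)) (at x)"
    and D: "\<And>i x. x \<in> S \<Longrightarrow> (D i has_derivative D' i x) (at x)"
    and cont: "\<And>i. continuous_on S (\<lambda>x. D' i x (axis i 1))"
    and harm: "\<And>x. x \<in> S \<Longrightarrow> (\<Sum>i\<in>UNIV. D' i x (axis i 1)) = 0"
  shows "\<bar>f y - c\<bar> \<le> s + s powr (1 - p) / \<sigma> ^ CARD('n)
     * (LINT x:S|lborel. \<bar>f x - c\<bar> powr p) / (LINT x|lborel. bump (x::real^'n))"
proof -
  define \<kappa> where "\<kappa> = (LINT x|lborel. bump (x::real^'n))"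
  \<comment> \<open>Extension by zero, so that the rescaled integral can be taken over the whole
    space.\<close>
  define g where "g x = indicator S x * \<bar>f x - c\<bar> powr p" for x
  have \<kappa>: "\<kappa> > 0" by (simp add: \<kappa>_def integral_bump_pos)
  have inS: "y + \<sigma> *\<^sub>R x \<in> S" if "norm x \<le> 1" for x
  proof -
    have "\<sigma> * norm x \<le> \<sigma> * 1" using that S(3) by (intro mult_left_mono) auto
    then show ?thesis using S by (auto simp: dist_norm)
  qed
  have contf: "continuous_on S f"
    using f by (auto intro!: continuous_at_imp_continuous_on has_derivative_continuous)
  have contf': "continuous_on (cball 0 1) (\<lambda>x. f (y + \<sigma> *\<^sub>R x))"
    by (intro continuous_on_compose2[OF contf] continuous_intros) (auto intro!: inS)
  have int_bump: "integrable lborel (bump :: real^'n \<Rightarrow> real)"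
    using integrable_bump_mult[of "\<lambda>_. 1"] by simp
  have intg: "integrable lborel g"
    using int by (simp add: g_def[abs_def] set_integrable_def)
  then have [measurable]: "g \<in> borel_measurable borel" by (auto dest: borel_measurable_integrable)
  have "\<kappa> * (f y - c) = (LINT x|lborel. bump x * (f (y + \<sigma> *\<^sub>R x) - c))"
  proof -
    have "(LINT x|lborel. bump x * (f (y + \<sigma> *\<^sub>R x) - c))
        = (LINT x|lborel. bump x * f (y + \<sigma> *\<^sub>R x)) - (LINT x|lborel. bump (x::real^'n) * c)"
      using integrable_bump_mult[OF contf'] int_bump by (simp add: right_diff_distrib)
    also have "(LINT x|lborel. bump x * f (y + \<sigma> *\<^sub>R x)) = f y * \<kappa>"
      unfolding \<kappa>_def using S(3)
      by (intro integral_bump_harmonic[OF S(1,2) _ f D cont harm]) auto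
    finally show ?thesis by (simp add: \<kappa>_def algebra_simps)
  qed
  then have "\<kappa> * \<bar>f y - c\<bar> = \<bar>LINT x|lborel. bump x * (f (y + \<sigma> *\<^sub>R x) - c)\<bar>"
    using \<kappa> by (metis abs_mult abs_of_pos)
  also have "\<dots> \<le> (LINT x|lborel. \<bar>bump x * (f (y + \<sigma> *\<^sub>R x) - c)\<bar>)"
    by (rule integral_abs_bound)
  also have "\<dots> \<le> (LINT x|lborel. s * bump x + s powr (1 - p) * g (y + \<sigma> *\<^sub>R x))"
  proof (rule integral_mono)
    show "integrable lborel (\<lambda>x. \<bar>bump x * (f (y + \<sigma> *\<^sub>R x) - c)\<bar>)"
      by (intro integrable_abs integrable_bump_mult continuous_intros contf')
    show "integrable lborel (\<lambda>x. s * bump x + s powr (1 - p) * g (y + \<sigma> *\<^sub>R x))"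
      using int_bump lborel_integrable_affine[OF intg S(3)] by simp
    show "\<bar>bump x * (f (y + \<sigma> *\<^sub>R x) - c)\<bar> \<le> s * bump x + s powr (1 - p) * g (y + \<sigma> *\<^sub>R x)" for x
    proof (cases "norm x \<le> 1")
      case True
      define b where "b = \<bar>f (y + \<sigma> *\<^sub>R x) - c\<bar>"
      \<comment> \<open>The weight is kept on the term \<open>s\<close>, whose integral then cancels
        against \<open>\<kappa>\<close>, and estimated by 1 on the power term.\<close>
      have "bump x * b \<le> bump x * (s + s powr (1 - p) * b powr p)"
        using abs_le_add_powr[OF s p, of b] bump_nonneg[of x]
        by (intro mult_left_mono) (auto simp: b_def)
      also have "\<dots> \<le> bump x * s + 1 * (s powr (1 - p) * b powr p)"
        using bump_le_1[of x] unfolding distrib_left by (intro add_left_mono mult_right_mono) auto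
      finally show ?thesis
        using inS[OF True] bump_nonneg[of x] by (simp add: g_def b_def abs_mult mult.commute)
    qed (simp add: bump_eq_0 g_def)
  qed
  also have "\<dots> = s * \<kappa> + s powr (1 - p) * ((LINT x|lborel. g x) / \<sigma> ^ CARD('n))"
    using int_bump lborel_integrable_affine[OF intg S(3)] lborel_integral_affine[of g \<sigma> y] S(3)
    by (simp add: \<kappa>_def)
  finally have "\<kappa> * \<bar>f y - c\<bar> \<le> \<kappa> * (s + s powr (1 - p) / \<sigma> ^ CARD('n) * (LINT x|lborel. g x) / \<kappa>)"
    using \<kappa> by (simp add: algebra_simps)
  then show ?thesis
    using \<kappa> by (simp add: \<kappa>_def g_def set_lebesgue_integral_def)
qed

text \<open>The factor from the barrier estimate, isolated to make visible that it depends only on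
  the dimension, the diameter and the exterior radius.\<close>

definition growth_const :: "nat \<Rightarrow> real \<Rightarrow> real \<Rightarrow> real" where
  "growth_const N d r = exp (N / r\<^sup>2 * (r + d)\<^sup>2) * (2 * r + d)"

text \<open>The interior estimate is applied at a point \<open>y\<close> at distance
  \<open>s\<close> from \<open>x\<close>, and the change of \<open>h\<close> from \<open>x\<close>
  to \<open>y\<close> is controlled directly. The constant \<open>c\<close> is arbitrary; the mean
  value enters only at the end.\<close>

lemma boundary_deviation_le:
  fixes \<Omega> :: "(real^'n::finite) set" and u :: "real^'n \<Rightarrow> real" and z :: "real^'n" and a c p :: real
  defines "h \<equiv> \<lambda>x. 1/2 * ((norm (x - z))\<^sup>2 - a) - u x"
  assumes p: "1 \<le> p" and \<Omega>: "bounded \<Omega>" "open \<Omega>" "interior_sphere \<Omega> ri" "exterior_sphere \<Omega> re"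
    and u: "torsion_solution \<Omega> u" and z: "z \<in> \<Omega>" and x: "x \<in> frontier \<Omega>" and s: "0 < s" "s < ri"
  shows "\<bar>h x - c\<bar> \<le> (1 + diameter \<Omega> + growth_const CARD('n) (diameter \<Omega>) re) * s
     + 2 ^ CARD('n) / (LINT x|lborel. bump (x::real^'n)) * s powr (1 - p - CARD('n))
       * (LINT x:\<Omega>|lborel. \<bar>h x - c\<bar> powr p)"
proof -
  define d where "d = diameter \<Omega>"
  obtain b where b: "ball b ri \<subseteq> \<Omega>" "closure (ball b ri) \<inter> frontier \<Omega> = {x}" and ri: "ri > 0"
    using \<Omega>(3) x by (auto simp: interior_sphere_def)
  have "x \<in> cball b ri" using b(2) ri by auto
  moreover have "x \<notin> ball b ri" using b(1) x \<Omega>(2) by (auto simp: frontier_def interior_open)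
  ultimately have bx: "norm (b - x) = ri" by (simp add: dist_norm)
  \<comment> \<open>The point at distance \<open>s\<close> from \<open>x\<close> on the radius of
    the touching ball. Its distance to the centre is \<open>ri - s\<close>, so the closed ball of
    radius \<open>s / 2\<close> around it stays inside.\<close>
  define y where "y = x + (s / ri) *\<^sub>R (b - x)"
  have yx: "norm (y - x) = s" using s ri by (simp add: y_def bx)
  have "b - y = (1 - s / ri) *\<^sub>R (b - x)" by (simp add: y_def algebra_simps)
  then have "norm (b - y) = \<bar>1 - s / ri\<bar> * ri" by (simp only: norm_scaleR bx)
  also have "\<bar>1 - s / ri\<bar> = 1 - s / ri" using s by simp
  finally have yb: "norm (b - y) = ri - s" using ri by (simp add: left_diff_distrib)
  have sub: "cball y (s / 2) \<subseteq> \<Omega>"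
  proof
    fix w assume "w \<in> cball y (s / 2)"
    then have "dist b w < ri" using dist_triangle[of b w y] yb s by (simp add: dist_norm)
    then show "w \<in> \<Omega>" using b(1) by auto
  qed
  then have y: "y \<in> \<Omega>" using s by auto
  have diam: "norm (v - z) \<le> d" if "v \<in> closure \<Omega>" for v
    using diameter_bounded_bound[of "closure \<Omega>" v z] that z closure_subset \<Omega>
    by (auto simp: d_def diameter_closure bounded_closure dist_norm)
  have "compact (closure \<Omega>)" using \<Omega> by (simp add: compact_closure)
  have conth: "continuous_on (closure \<Omega>) h"
    using u unfolding h_def by (auto simp: torsion_solution_def intro!: continuous_intros)
  have contp: "continuous_on (closure \<Omega>) (\<lambda>x. \<bar>h x - c\<bar> powr p)"
    using p by (intro continuous_on_powr' continuous_intros conth) auto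
  have int: "set_integrable lborel \<Omega> (\<lambda>x. \<bar>h x - c\<bar> powr p)"
  proof (rule set_integrable_subset)
    show "set_integrable lborel (closure \<Omega>) (\<lambda>x. \<bar>h x - c\<bar> powr p)"
      unfolding set_integrable_def
      using borel_integrable_compact[OF \<open>compact (closure \<Omega>)\<close> contp] .
  qed (use \<Omega>(2) closure_subset in auto)
  \<comment> \<open>Gradient of \<open>h\<close> and differentials of its components. The diagonal
    entries \<open>D' i x (axis i 1)\<close> sum to N - N = 0, so \<open>h\<close> is
    harmonic.\<close>
  define D where "D i x = (x - z) $ i - partial_deriv i u x" for i x
  define D' where "D' i x v = v $ i - frechet_derivative (partial_deriv i u) (at x) v" for i x v
  have C2: "C2_on \<Omega> u" using u by (simp add: torsion_solution_def)
  have "\<bar>h y - c\<bar> \<le> s + s powr (1 - p) / (s / 2) ^ CARD('n)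
     * (LINT x:\<Omega>|lborel. \<bar>h x - c\<bar> powr p) / (LINT x|lborel. bump (x::real^'n))"
  proof (rule interior_deviation_le[where D = D and D' = D', OF p \<Omega>(2) sub _ s(1) int])
    fix x assume x: "x \<in> \<Omega>"
    have "(u has_derivative frechet_derivative u (at x)) (at x)"
      using C2 x by (simp add: C2_on_def frechet_derivative_works)
    moreover from this have "linear (frechet_derivative u (at x))" by (rule has_derivative_linear)
    ultimately have "(h has_derivative (\<lambda>v. (x - z) \<bullet> v - frechet_derivative u (at x) v)) (at x)"
      unfolding h_def dot_square_norm[symmetric]
      by (auto intro!: derivative_eq_intros simp: inner_commute)
    moreover have "(x - z) \<bullet> v - frechet_derivative u (at x) v = (\<Sum>i\<in>UNIV. D i x * v $ i)" for v
    proof -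
      have "frechet_derivative u (at x) v = frechet_derivative u (at x) (\<Sum>i\<in>UNIV. v $ i *\<^sub>R axis i 1)"
        by (simp add: basis_expansion flip: scalar_mult_eq_scaleR)
      also have "\<dots> = (\<Sum>i\<in>UNIV. v $ i * partial_deriv i u x)"
        using \<open>linear (frechet_derivative u (at x))\<close>
        by (simp add: linear_sum linear_cmul partial_deriv_def)
      finally show ?thesis
        by (simp add: D_def inner_vec_def algebra_simps sum_subtractf sum.distrib)
    qed
    ultimately show "(h has_derivative (\<lambda>v. \<Sum>i\<in>UNIV. D i x * v $ i)) (at x)" by simp
    show "(D i has_derivative D' i x) (at x)" for i
    proof -
      have "(partial_deriv i u has_derivative frechet_derivative (partial_deriv i u) (at x)) (at x)"
        using C2 x by (simp add: C2_on_def frechet_derivative_works)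
      then show ?thesis
        unfolding D_def[abs_def] D'_def[abs_def]
        by (auto intro!: derivative_eq_intros
            bounded_linear_imp_has_derivative[OF bounded_linear_vec_nth])
    qed
    show "(\<Sum>i\<in>UNIV. D' i x (axis i 1)) = 0"
      using u x by (simp add: D'_def sum_subtractf torsion_solution_def laplacian_def partial_deriv_def)
  next
    show "continuous_on \<Omega> (\<lambda>x. D' i x (axis i 1))" for i
      using C2 unfolding D'_def C2_on_def partial_deriv_def[symmetric]
      by (auto intro!: continuous_intros)
  qed (use s in simp)
  moreover have "s powr (1 - p) / (s / 2) ^ CARD('n) = 2 ^ CARD('n) * s powr (1 - p - CARD('n))"
    using s by (simp add: powr_diff powr_realpow power_divide)
  ultimately have 1: "\<bar>h y - c\<bar> \<le> s + 2 ^ CARD('n) / (LINT x|lborel. bump (x::real^'n))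
     * s powr (1 - p - CARD('n)) * (LINT x:\<Omega>|lborel. \<bar>h x - c\<bar> powr p)"
    by simp
  \<comment> \<open>The quadratic part changes by at most \<open>d * s\<close>; since
    \<open>u x = 0\<close>, the rest is \<open>\<bar>u y\<bar>\<close>, bounded by the
    barrier.\<close>
  have 2: "\<bar>h x - h y\<bar> \<le> d * s + growth_const CARD('n) d re * s"
  proof -
    have "\<bar>(norm (x - z))\<^sup>2 - (norm (y - z))\<^sup>2\<bar>
        = (norm (x - z) + norm (y - z)) * \<bar>norm (x - z) - norm (y - z)\<bar>"
      by (simp add: power2_eq_square square_diff_square_factored abs_mult)
    also have "\<dots> \<le> (d + d) * s"
    proof (intro mult_mono add_mono diam)
      show "\<bar>norm (x - z) - norm (y - z)\<bar> \<le> s"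
        using norm_triangle_ineq3[of "x - z" "y - z"] yx by (simp add: norm_minus_commute)
    qed (use x y closure_subset diam[of z] z in \<open>auto simp: frontier_def\<close>)
    finally have "\<bar>(norm (x - z))\<^sup>2 - (norm (y - z))\<^sup>2\<bar> \<le> 2 * (d * s)" by simp
    moreover have "\<bar>u y\<bar> \<le> growth_const CARD('n) d re * s"
      using torsion_solution_boundary_growth[OF \<Omega>(1,2,4) u x y] yx
      by (simp add: growth_const_def d_def)
    moreover have "\<bar>h x - h y\<bar> \<le> \<bar>(norm (x - z))\<^sup>2 - (norm (y - z))\<^sup>2\<bar> / 2 + \<bar>u y\<bar>"
    proof -
      have "h x - h y = ((norm (x - z))\<^sup>2 - (norm (y - z))\<^sup>2) / 2 + u y"
        using u x by (simp add: h_def torsion_solution_def field_simps)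
      then show ?thesis
        using abs_triangle_ineq[of "((norm (x - z))\<^sup>2 - (norm (y - z))\<^sup>2) / 2" "u y"] by simp
    qed
    ultimately show ?thesis by simp
  qed
  have "\<bar>h x - c\<bar> \<le> \<bar>h x - h y\<bar> + \<bar>h y - c\<bar>" by simp
  with 1 2 show ?thesis by (simp add: d_def algebra_simps)
qed

section \<open>Stability of the radii\<close>

text \<open>A ball of any radius on the far side of a supporting hyperplane, tangent to it at
  \<open>y\<close>, meets the closure only at \<open>y\<close>.\<close>

lemma convex_imp_exterior_sphere:
  fixes \<Omega> :: "(real^'n::finite) set"
  assumes "convex \<Omega>" "open \<Omega>" "r > 0"
  shows "exterior_sphere \<Omega> r"
  unfolding exterior_sphere_def
proof (intro conjI ballI)
  fix y assume y: "y \<in> frontier \<Omega>"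
  then have "y \<in> closure \<Omega>" "y \<notin> rel_interior \<Omega>"
    using assms(2) by (auto simp: frontier_def interior_open rel_interior_open)
  then obtain a where a: "a \<noteq> 0" "\<And>z. z \<in> closure \<Omega> \<Longrightarrow> a \<bullet> y \<le> a \<bullet> z"
    using supporting_hyperplane_relative_frontier[OF assms(1)] by metis
  define e where "e = (r / norm a) *\<^sub>R a"
  have e: "norm e = r" using a(1) assms(3) by (simp add: e_def)
  \<comment> \<open>The vector \<open>e\<close> points to the side of the domain, so
    \<open>(z - y) \<bullet> e\<close> is nonnegative. This inequality gives both the disjointness
    of the open ball and the uniqueness of the contact point.\<close>
  have far: "(norm (z - y))\<^sup>2 + r\<^sup>2 \<le> (norm (z - (y - e)))\<^sup>2" if "z \<in> closure \<Omega>" for z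
  proof -
    have "0 \<le> (z - y) \<bullet> e"
      using a(2)[OF that] assms(3) by (simp add: e_def inner_diff_right inner_commute)
    moreover have "z - (y - e) = (z - y) + e" by simp
    ultimately show ?thesis
      using dot_norm[of "z - y" e] e by (simp add: field_simps)
  qed
  show "\<exists>c. ball c r \<subseteq> - closure \<Omega> \<and> closure (ball c r) \<inter> frontier \<Omega> = {y}"
  proof (intro exI conjI)
    show "ball (y - e) r \<subseteq> - closure \<Omega>"
    proof
      fix z assume "z \<in> ball (y - e) r"
      then have "(norm (z - (y - e)))\<^sup>2 < r\<^sup>2"
        by (intro power_strict_mono) (auto simp: dist_norm norm_minus_commute)
      then show "z \<in> - closure \<Omega>" using far[of z] zero_le_power2[of "norm (z - y)"] by fastforce
    qed
    show "closure (ball (y - e) r) \<inter> frontier \<Omega> = {y}"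
    proof
      show "closure (ball (y - e) r) \<inter> frontier \<Omega> \<subseteq> {y}"
      proof
        fix z assume z: "z \<in> closure (ball (y - e) r) \<inter> frontier \<Omega>"
        then have "norm (z - (y - e)) \<le> r"
          using assms(3) by (auto simp: dist_norm norm_minus_commute)
        then have "(norm (z - (y - e)))\<^sup>2 \<le> r\<^sup>2" by (intro power_mono) auto
        moreover have "z \<in> closure \<Omega>" using z by (simp add: frontier_def)
        ultimately have "(norm (z - y))\<^sup>2 \<le> 0" using far[OF \<open>z \<in> closure \<Omega>\<close>] by linarith
        then show "z \<in> {y}" by simp
      qed
      show "{y} \<subseteq> closure (ball (y - e) r) \<inter> frontier \<Omega>"
        using y e assms(3) by (simp add: dist_norm)
    qed
  qed
qed (fact assms(3))

section \<open>The two radii and the choice of scale\<close>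

lemma rho_attained:
  fixes \<Omega> :: "(real^'n::finite) set"
  assumes "bounded \<Omega>" "frontier \<Omega> \<noteq> {}"
  obtains x y where "x \<in> frontier \<Omega>" "y \<in> frontier \<Omega>"
    "rho_i \<Omega> z = norm (x - z)" "rho_e \<Omega> z = norm (y - z)"
    "\<And>v. v \<in> frontier \<Omega> \<Longrightarrow> norm (v - z) \<le> rho_e \<Omega> z"
proof -
  have cont: "continuous_on (frontier \<Omega>) (\<lambda>x. norm (x - z))" by (intro continuous_intros)
  have comp: "compact (frontier \<Omega>)" using assms(1) by (rule compact_frontier_bounded)
  obtain x where x: "x \<in> frontier \<Omega>" "\<And>v. v \<in> frontier \<Omega> \<Longrightarrow> norm (x - z) \<le> norm (v - z)"
    using continuous_attains_inf[OF comp assms(2) cont] by blast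
  obtain y where y: "y \<in> frontier \<Omega>" "\<And>v. v \<in> frontier \<Omega> \<Longrightarrow> norm (v - z) \<le> norm (y - z)"
    using continuous_attains_sup[OF comp assms(2) cont] by blast
  have "rho_i \<Omega> z = norm (x - z)"
    unfolding rho_i_def using x by (intro cInf_eq_minimum) auto
  moreover have "rho_e \<Omega> z = norm (y - z)"
    unfolding rho_e_def using y by (intro cSup_eq_maximum) auto
  ultimately show ?thesis using that x y by simp
qed

text \<open>From the centre of an interior ball, a ray in a direction \<open>l\<close> that does not
  approach \<open>z\<close> leaves the domain only after length \<open>r\<close>, and its distance
  to \<open>z\<close> is at least the length travelled. Hence \<open>rho_e\<close> is at least the
  interior radius.\<close>

lemma interior_sphere_le_frontier_dist:
  fixes \<Omega> :: "(real^'n::finite) set"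
  assumes "bounded \<Omega>" "open \<Omega>" "interior_sphere \<Omega> r" "frontier \<Omega> \<noteq> {}"
  obtains v where "v \<in> frontier \<Omega>" "r \<le> norm (v - z)"
proof -
  obtain y where "y \<in> frontier \<Omega>" using assms(4) by blast
  then obtain b where b: "ball b r \<subseteq> \<Omega>" and r: "r > 0"
    using assms(3) unfolding interior_sphere_def by blast
  \<comment> \<open>Of any unit vector and its negative, one has nonnegative inner product with
    \<open>b - z\<close>.\<close>
  obtain l :: "real^'n" where l: "norm l = 1" "0 \<le> (b - z) \<bullet> l"
  proof -
    obtain l :: "real^'n" where "norm l = 1" using vector_choose_size[of 1] by auto
    then show ?thesis
      using that[of l] that[of "- l"] by (cases "0 \<le> (b - z) \<bullet> l") (simp_all add: inner_minus_right)
  qed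
  have "b \<in> interior \<Omega>" using b r assms(2) by (auto simp: interior_open)
  moreover have "l \<noteq> 0" using l(1) by auto
  ultimately obtain t where t: "t > 0" "b + t *\<^sub>R l \<in> frontier \<Omega>"
    using ray_to_frontier[OF assms(1)] by metis
  have "b + t *\<^sub>R l \<notin> ball b r" using b t(2) assms(2) by (auto simp: frontier_def interior_open)
  then have "r \<le> t" using t l by (simp add: dist_norm)
  have eq: "b + t *\<^sub>R l - z = (b - z) + t *\<^sub>R l" by simp
  have "(norm (b + t *\<^sub>R l - z))\<^sup>2 = (norm (b - z))\<^sup>2 + 2 * (t * ((b - z) \<bullet> l)) + t\<^sup>2"
    unfolding eq using dot_norm[of "b - z" "t *\<^sub>R l"] l(1) by simp
  moreover have "0 \<le> t * ((b - z) \<bullet> l)" using t l by simp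
  ultimately have "t\<^sup>2 \<le> (norm (b + t *\<^sub>R l - z))\<^sup>2" by simp
  then have "t \<le> norm (b + t *\<^sub>R l - z)" by (rule power2_le_imp_le) simp
  with \<open>r \<le> t\<close> have "r \<le> norm (b + t *\<^sub>R l - z)" by linarith
  with t(2) show ?thesis by (rule that)
qed

text \<open>The scale \<open>L = I powr (1 / (N + p))\<close> turns both terms into multiples of
  \<open>L\<close>. It is admissible only for 0 < L < r; for larger \<open>L\<close> the crude bound
  \<open>d\<close> suffices, and for \<open>L = 0\<close> the scale \<open>s\<close> is taken
  small.\<close>

lemma le_optimized_scale:
  fixes K1 K2 I R d r N p :: real
  assumes "K1 \<ge> 0" "K2 \<ge> 0" "I \<ge> 0" "d \<ge> 0" "r > 0" "p \<ge> 1" "N \<ge> 0" and R: "R \<le> d"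
    and bound: "\<And>s. 0 < s \<Longrightarrow> s < r \<Longrightarrow> R \<le> K1 * s + K2 * s powr (1 - p - N) * I"
  shows "R \<le> (K1 + K2 + d / r) * (I powr (1 / p)) powr (p / (N + p))"
proof -
  define L where "L = I powr (1 / (N + p))"
  have L: "(I powr (1 / p)) powr (p / (N + p)) = L" using assms by (simp add: L_def powr_powr)
  have "R \<le> (K1 + K2 + d / r) * L"
  proof -
    have "L \<ge> 0" by (simp add: L_def)
    then consider "L \<ge> r" | "0 < L" "L < r" | "L = 0" by linarith
    then show ?thesis
    proof cases
      case 1
      have "R \<le> d / r * r" using R assms by simp
      also have "\<dots> \<le> (K1 + K2 + d / r) * L" using 1 assms by (intro mult_mono) auto
      finally show ?thesis .
    next
      case 2
      have "I = L powr (N + p)" using assms by (simp add: L_def powr_powr)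
      then have "L powr (1 - p - N) * I = L" using 2 by (simp add: powr_add[symmetric])
      then have "R \<le> K1 * L + K2 * L" using bound[OF 2] by (simp add: mult.assoc)
      also have "\<dots> \<le> (K1 + K2 + d / r) * L" using 2 assms by (simp add: distrib_right)
      finally show ?thesis .
    next
      case 3
      then have "I = 0" by (simp add: L_def)
      have "R \<le> 0"
      proof (rule ccontr)
        assume R: "\<not> R \<le> 0"
        \<comment> \<open>Small enough that \<open>K1 * s \<le> R / 2\<close>; the
          \<open>+ 1\<close> keeps the denominator positive when \<open>K1 = 0\<close>.\<close>
        define s where "s = min (r / 2) (R / (2 * (K1 + 1)))"
        have s: "0 < s" "s < r" using R assms by (auto simp: s_def)
        have "R \<le> K1 * s" using bound[OF s] \<open>I = 0\<close> by simp
        also have "\<dots> \<le> (K1 + 1) * (R / (2 * (K1 + 1)))"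
          using assms s by (intro mult_mono) (auto simp: s_def)
        also have "\<dots> = R / 2" using assms by (simp add: field_simps)
        finally show False using R by simp
      qed
      with 3 show ?thesis by simp
    qed
  qed
  then show ?thesis by (simp add: L)
qed

text \<open>The shape \<open>K1 + K2 + d / r\<close> comes from the choice of scale. In 4 / ri, one
  factor 2 undoes the 1/2 in \<open>q\<close>, another counts two boundary points, and ri bounds
  \<open>rho_e + rho_i\<close> from below. The type argument carries the dimension.\<close>

definition stability_const :: "'n::finite itself \<Rightarrow> real \<Rightarrow> real \<Rightarrow> real \<Rightarrow> real" where
  "stability_const _ d ri re =
     4 / ri * (1 + d + growth_const CARD('n) d re)
     + 4 / ri * (2 ^ CARD('n) / (LINT x|lborel. bump (x::real^'n))) + d / ri"

lemma stability_const_pos: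
  assumes "d \<ge> 0" "ri > 0" "re > 0"
  shows "0 < stability_const TYPE('n::finite) d ri re"
proof -
  have "0 \<le> growth_const CARD('n) d re" using assms by (simp add: growth_const_def)
  then show ?thesis
    unfolding stability_const_def using assms integral_bump_pos[where 'a = "real^'n"]
    by (intro add_pos_nonneg mult_pos_pos) (auto intro!: divide_nonneg_nonneg mult_nonneg_nonneg)
qed

lemma rho_difference_le:
  fixes \<Omega> :: "(real^'n::finite) set" and u :: "real^'n \<Rightarrow> real" and z :: "real^'n" and a c p :: real
  defines "h \<equiv> \<lambda>x. 1/2 * ((norm (x - z))\<^sup>2 - a) - u x"
  assumes p: "1 \<le> p" and \<Omega>: "bounded \<Omega>" "open \<Omega>" "interior_sphere \<Omega> ri" "exterior_sphere \<Omega> re"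
    and u: "torsion_solution \<Omega> u" and z: "z \<in> \<Omega>"
  shows "rho_e \<Omega> z - rho_i \<Omega> z \<le> stability_const TYPE('n) (diameter \<Omega>) ri re
     * Lp_norm p \<Omega> (\<lambda>x. h x - c) powr (p / (CARD('n) + p))"
proof -
  define d where "d = diameter \<Omega>"
  define K1 where "K1 = 1 + d + growth_const CARD('n) d re"
  define K2 where "K2 = 2 ^ CARD('n) / (LINT x|lborel. bump (x::real^'n))"
  define I where "I = (LINT x:\<Omega>|lborel. \<bar>h x - c\<bar> powr p)"
  have d: "d \<ge> 0" using \<Omega>(1) by (simp add: d_def diameter_ge_0)
  have ri: "ri > 0" and re: "re > 0" using \<Omega> by (auto simp: interior_sphere_def exterior_sphere_def)
  have K1: "K1 \<ge> 0" using d re by (simp add: K1_def growth_const_def)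
  have K2: "K2 \<ge> 0" by (simp add: K2_def integral_bump_pos less_imp_le)
  have I: "I \<ge> 0" unfolding I_def set_lebesgue_integral_def by (intro integral_nonneg_AE) auto
  have fr: "frontier \<Omega> \<noteq> {}" using \<Omega>(1) z frontier_eq_empty[of \<Omega>] not_bounded_UNIV by auto
  obtain xi xe where x: "xi \<in> frontier \<Omega>" "xe \<in> frontier \<Omega>"
    "rho_i \<Omega> z = norm (xi - z)" "rho_e \<Omega> z = norm (xe - z)"
    and le: "\<And>v. v \<in> frontier \<Omega> \<Longrightarrow> norm (v - z) \<le> rho_e \<Omega> z"
    using rho_attained[OF \<Omega>(1) fr] by metis
  obtain v where "v \<in> frontier \<Omega>" "ri \<le> norm (v - z)"
    using interior_sphere_le_frontier_dist[OF \<Omega>(1,2,3) fr] by metis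
  with le have re_ri: "ri \<le> rho_e \<Omega> z" by force
  have rho_le: "rho_i \<Omega> z \<le> rho_e \<Omega> z" using le[OF x(1)] x(3) by simp
  have "rho_e \<Omega> z - rho_i \<Omega> z \<le> (4 / ri * K1 + 4 / ri * K2 + d / ri)
      * (I powr (1 / p)) powr (p / (CARD('n) + p))"
  proof (rule le_optimized_scale[OF _ _ I d ri p])
    have "norm (xe - z) \<le> d"
      using diameter_bounded_bound[of "closure \<Omega>" xe z] x(2) z closure_subset \<Omega>
      by (auto simp: d_def diameter_closure bounded_closure dist_norm frontier_def)
    then show "rho_e \<Omega> z - rho_i \<Omega> z \<le> d" using x(3,4) norm_ge_zero[of "xi - z"] by linarith
    fix s :: real assume s: "0 < s" "s < ri"
    have dev: "\<bar>h x - c\<bar> \<le> K1 * s + K2 * s powr (1 - p - CARD('n)) * I" if "x \<in> frontier \<Omega>" for x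
      using boundary_deviation_le[OF p \<Omega> u z that s, of a c]
      by (simp add: h_def K1_def K2_def I_def d_def)
    have u0: "u xe = 0" "u xi = 0" using u x by (auto simp: torsion_solution_def)
    \<comment> \<open>A lower bound for the sum of the radii converts the difference of squares,
      which \<open>h\<close> controls, into the difference itself. The constant \<open>a\<close>
      cancels between the two boundary points.\<close>
    have "ri * (rho_e \<Omega> z - rho_i \<Omega> z) \<le> (rho_e \<Omega> z + rho_i \<Omega> z) * (rho_e \<Omega> z - rho_i \<Omega> z)"
      using re_ri rho_le x(3) norm_ge_zero[of "xi - z"] by (intro mult_right_mono) linarith+
    also have "\<dots> = 2 * (h xe - h xi)"
      using u0 x(3,4) by (simp add: h_def power2_eq_square algebra_simps)
    also have "\<dots> \<le> 2 * (\<bar>h xe - c\<bar> + \<bar>h xi - c\<bar>)"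
      using abs_ge_self[of "h xe - c"] abs_ge_minus_self[of "h xi - c"] by simp
    also have "\<dots> \<le> 4 * (K1 * s + K2 * s powr (1 - p - CARD('n)) * I)"
      using dev[OF x(1)] dev[OF x(2)] by simp
    finally have "rho_e \<Omega> z - rho_i \<Omega> z \<le> 4 * (K1 * s + K2 * s powr (1 - p - CARD('n)) * I) / ri"
      using ri by (simp add: pos_le_divide_eq mult.commute)
    then show "rho_e \<Omega> z - rho_i \<Omega> z \<le> 4 / ri * K1 * s + 4 / ri * K2 * s powr (1 - p - CARD('n)) * I"
      by (simp add: add_divide_distrib distrib_left mult.assoc)
  qed (use K1 K2 ri in auto)
  then show ?thesis
    by (simp add: stability_const_def Lp_norm_def I_def K1_def K2_def d_def)
qed

theorem lemma3p17:
  fixes p :: real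
  assumes "CARD('n::finite) \<ge> 2" and "p \<ge> 1"
  shows
    "(\<forall>d r_i r_e. \<exists>C>0. \<forall>(\<Omega> :: (real^'n) set) u z a.
        bounded \<Omega> \<and> domain \<Omega> \<and> C2_boundary \<Omega> \<and> diameter \<Omega> = d \<and>
        interior_sphere \<Omega> r_i \<and> exterior_sphere \<Omega> r_e \<and>
        torsion_solution \<Omega> u \<and> z \<in> \<Omega> \<longrightarrow>
        (let q = (\<lambda>x. 1/2 * ((norm (x - z))\<^sup>2 - a)); h = (\<lambda>x. q x - u x) in
          rho_e \<Omega> z - rho_i \<Omega> z
            \<le> C * Lp_norm p \<Omega> (\<lambda>x. h x - mean_value \<Omega> h) powr (p / (real CARD('n) + p)))) \<and>
     (\<forall>d r_i. \<exists>C>0. \<forall>(\<Omega> :: (real^'n) set) u z a.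
        bounded \<Omega> \<and> domain \<Omega> \<and> C2_boundary \<Omega> \<and> convex \<Omega> \<and> diameter \<Omega> = d \<and>
        interior_sphere \<Omega> r_i \<and>
        torsion_solution \<Omega> u \<and> z \<in> \<Omega> \<longrightarrow>
        (let q = (\<lambda>x. 1/2 * ((norm (x - z))\<^sup>2 - a)); h = (\<lambda>x. q x - u x) in
          rho_e \<Omega> z - rho_i \<Omega> z
            \<le> C * Lp_norm p \<Omega> (\<lambda>x. h x - mean_value \<Omega> h) powr (p / (real CARD('n) + p))))"
proof -
  \<comment> \<open>The constant must be positive for all real parameters; the default 1 covers
    those for which no admissible domain exists.\<close>
  define C where "C d ri re
      = (if 0 \<le> d \<and> 0 < ri \<and> 0 < re then stability_const TYPE('n) d ri re else 1)" for d ri re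
  have C: "0 < C d ri re" for d ri re by (simp add: C_def stability_const_pos)
  have main: "let q = (\<lambda>x. 1/2 * ((norm (x - z))\<^sup>2 - a)); h = (\<lambda>x. q x - u x) in
      rho_e \<Omega> z - rho_i \<Omega> z
        \<le> C (diameter \<Omega>) ri re * Lp_norm p \<Omega> (\<lambda>x. h x - mean_value \<Omega> h) powr (p / (real CARD('n) + p))"
    if "bounded \<Omega>" "domain \<Omega>" "interior_sphere \<Omega> ri" "exterior_sphere \<Omega> re"
      "torsion_solution \<Omega> u" "z \<in> \<Omega>" for \<Omega> :: "(real^'n) set" and u z a ri re
  proof -
    have "C (diameter \<Omega>) ri re = stability_const TYPE('n) (diameter \<Omega>) ri re"
      using that by (simp add: C_def interior_sphere_def exterior_sphere_def diameter_ge_0)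
    moreover have "open \<Omega>" using that by (simp add: domain_def)
    ultimately show ?thesis
      unfolding Let_def
      using rho_difference_le[OF assms(2) that(1) _ that(3-6)] by simp
  qed
  show ?thesis
  proof (intro conjI allI)
    fix d ri re :: real
    show "\<exists>C>0. \<forall>(\<Omega> :: (real^'n) set) u z a.
        bounded \<Omega> \<and> domain \<Omega> \<and> C2_boundary \<Omega> \<and> diameter \<Omega> = d \<and>
        interior_sphere \<Omega> ri \<and> exterior_sphere \<Omega> re \<and>
        torsion_solution \<Omega> u \<and> z \<in> \<Omega> \<longrightarrow>
        (let q = (\<lambda>x. 1/2 * ((norm (x - z))\<^sup>2 - a)); h = (\<lambda>x. q x - u x) in
          rho_e \<Omega> z - rho_i \<Omega> z
            \<le> C * Lp_norm p \<Omega> (\<lambda>x. h x - mean_value \<Omega> h) powr (p / (real CARD('n) + p)))"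
    proof (intro exI[of _ "C d ri re"] conjI C allI impI, elim conjE, goal_cases)
      case (1 \<Omega> u z a)
      from main[OF 1(1,2,5-8), of a] show ?case by (simp only: 1(4))
    qed
  next
    fix d ri :: real
    \<comment> \<open>Every exterior radius is available for a convex domain; fixing it to 1 makes
      the constant depend on \<open>d\<close> and \<open>ri\<close> alone, besides N and p.\<close>
    have ext: "exterior_sphere \<Omega> 1" if "convex \<Omega>" "domain \<Omega>" for \<Omega> :: "(real^'n) set"
      using that by (intro convex_imp_exterior_sphere) (auto simp: domain_def)
    show "\<exists>C>0. \<forall>(\<Omega> :: (real^'n) set) u z a.
        bounded \<Omega> \<and> domain \<Omega> \<and> C2_boundary \<Omega> \<and> convex \<Omega> \<and> diameter \<Omega> = d \<and>
        interior_sphere \<Omega> ri \<and>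
        torsion_solution \<Omega> u \<and> z \<in> \<Omega> \<longrightarrow>
        (let q = (\<lambda>x. 1/2 * ((norm (x - z))\<^sup>2 - a)); h = (\<lambda>x. q x - u x) in
          rho_e \<Omega> z - rho_i \<Omega> z
            \<le> C * Lp_norm p \<Omega> (\<lambda>x. h x - mean_value \<Omega> h) powr (p / (real CARD('n) + p)))"
    proof (intro exI[of _ "C d ri 1"] conjI C allI impI, elim conjE, goal_cases)
      case (1 \<Omega> u z a)
      from main[OF 1(1,2,6) ext[OF 1(4,2)] 1(7,8), of a] show ?case by (simp only: 1(5))
    qed
  qed
qed

end
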